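(* Let $\mathcal S\subset \mathbb H^1$ be a graphical strip. Then $\mathcal S$ is $H$-minimal and it has empty characteristic locus. Moreover, when $I=\mathbb R$, every surface of the form $\mathcal S=\{(x,y,t)\in\mathbb H^1 \mid (y,t)\in \mathbb R\times I,\ x=yG(t)\}$, or of the form $\mathcal S=\{(x,y,t)\in\mathbb H^1 \mid (x,t)\in \mathbb R\times I,\ y=-xG(t)\}$, with $G\in C^2(I)$ and $G'\ge 0$ on $I$, is a global intrinsic $H$-minimal graph.
   Context: $\mathbb H^1$ is $\mathbb R^3$ with the group law $(x,y,t)\circ(x',y',t')=(x+x',y+y',t+t'+\tfrac12(xy'-x'y))$. Left-invariant vector fields: $X_1=\partial_x-\tfrac y2\partial_t$, $X_2=\partial_y+\tfrac x2\partial_t$, $T=\partial_t$. The horizontal plane at $g$ is $H_g\mathbb H^1=\mathrm{span}\{X_1(g),X_2(g)\}$. The characteristic locus of a $C^2$ surface $\mathcal S$ is $\Sigma(\mathcal S)=\{g\in\mathcal S\mid T_g\mathcal S=H_g\mathbb H^1\}$. If $\Sigma(\mathcal S)=\varnothing$, the $H$-mean curvature of $\mathcal S$ is, for a local $C^2$ defining function $\phi$ (with $\nabla \phi\ne0$), the restriction to $\mathcal S$ of $\mathcal H=X_1\bar p+X_2\bar q$, where $\bar p=X_1\phi/W$, $\bar q=X_2\phi/W$, $W=\sqrt{(X_1\phi)^2+(X_2\phi)^2}$ (on $\mathcal S$ this depends on $\phi$ only up to sign, i.e. orientation). $\mathcal S$ is $H$-minimal if $\mathcal H\equiv0$ on $\mathcal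 S$. Graphical strip: a $C^2$ surface $\mathcal S\subset\mathbb H^1$ for which there exist an (open) interval $I\subset\mathbb R$ and $G\in C^2(I)$ with $G'\ge0$ on $I$ such that, after possibly a left-translation and a rotation about the $t$-axis, either $\mathcal S=\{(x,y,t)\mid (y,t)\in\mathbb R\times I,\ x=yG(t)\}$ or $\mathcal S=\{(x,y,t)\mid (x,t)\in\mathbb R\times I,\ y=-xG(t)\}$. Intrinsic graphs: $\mathcal S$ is an intrinsic $X_1$-graph if there are an open set $\Omega\subset\mathbb R^2_{u,v}$ and a $C^2$ function $\phi:\Omega\to\mathbb R$ with $\mathcal S=\{(0,u,v)\circ(\phi(u,v),0,0)\mid (u,v)\in\Omega\}=\{(\phi(u,v),u,v-\tfrac u2\phi(u,v))\mid (u,v)\in\Omega\}$; it is an intrinsic $X_2$-graph if $\mathcal S=\{(u,0,v)\circ(0,\phi(u,v),0)\mid (u,v)\in\Omega\}=\{(u,\phi(u,v),v+\tfrac u2\phi(u,v))\mid (u,v)\in\Omega\}$. It is a global intrinsic graph if it is an intrinsic $X_1$-graph or an intrinsic $X_2$-graph with $\Omega=\mathbb R^2$; it is a global intrinsic $H$-minimal graph if moreover it is $H$-minimal. *)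

theory Defs
  imports "HOL-Analysis.Analysis"
begin

section \<open>Functions of class C^2 on an open set\<close>

definition C2_on :: "('a::real_normed_vector \<Rightarrow> real) \<Rightarrow> 'a set \<Rightarrow> bool" where
  "C2_on f U \<longleftrightarrow> open U \<and>
     (\<exists>(f' :: 'a \<Rightarrow> 'a \<Rightarrow>\<^sub>L real) (f'' :: 'a \<Rightarrow> 'a \<Rightarrow>\<^sub>L 'a \<Rightarrow>\<^sub>L real).
        (\<forall>x\<in>U. (f has_derivative blinfun_apply (f' x)) (at x)) \<and>
        (\<forall>x\<in>U. (f' has_derivative blinfun_apply (f'' x)) (at x)) \<and>
        continuous_on U f'')"


section \<open>The Heisenberg group\<close>

type_synonym heis = "real \<times> real \<times> real"

fun hmult :: "heis \<Rightarrow> heis \<Rightarrow> heis" where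
  "hmult (x, y, t) (x', y', t') = (x + x', y + y', t + t' + (x * y' - x' * y) / 2)"

fun hrot :: "real \<Rightarrow> heis \<Rightarrow> heis" where
  "hrot \<theta> (x, y, t) = (x * cos \<theta> - y * sin \<theta>, x * sin \<theta> + y * cos \<theta>, t)"

fun X1 :: "heis \<Rightarrow> heis" where
  "X1 (x, y, t) = (1, 0, - y / 2)"

fun X2 :: "heis \<Rightarrow> heis" where
  "X2 (x, y, t) = (0, 1, x / 2)"

definition horizontal_plane :: "heis \<Rightarrow> heis set" where
  "horizontal_plane g = span {X1 g, X2 g}"

text \<open>Vector fields acting on functions as first-order differential operators.\<close>

definition vf_deriv :: "(heis \<Rightarrow> heis) \<Rightarrow> (heis \<Rightarrow> real) \<Rightarrow> heis \<Rightarrow> real" where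
  "vf_deriv X f g = frechet_derivative f (at g) (X g)"


section \<open>Surfaces and their characteristic locus\<close>

definition local_defining_function :: "heis set \<Rightarrow> heis set \<Rightarrow> (heis \<Rightarrow> real) \<Rightarrow> bool" where
  "local_defining_function S U \<phi> \<longleftrightarrow> C2_on \<phi> U \<and>
     (\<forall>g\<in>U. frechet_derivative \<phi> (at g) \<noteq> (\<lambda>v. 0)) \<and>
     S \<inter> U = {g \<in> U. \<phi> g = 0}"

definition C2_surface :: "heis set \<Rightarrow> bool" where
  "C2_surface S \<longleftrightarrow> (\<forall>g\<in>S. \<exists>U \<phi>. g \<in> U \<and> local_defining_function S U \<phi>)"

text \<open>Tangent vectors are velocities of \<open>C\<^sup>1\<close> curves lying in the surface.\<close>

definition tangent_space :: "heis set \<Rightarrow> heis \<Rightarrow> heis set" where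
  "tangent_space S g = {v. \<exists>\<epsilon> \<gamma>. \<epsilon> > 0 \<and> \<gamma> C1_differentiable_on {-\<epsilon><..<\<epsilon>} \<and>
     \<gamma> ` {-\<epsilon><..<\<epsilon>} \<subseteq> S \<and> \<gamma> 0 = g \<and> (\<gamma> has_vector_derivative v) (at 0)}"

definition char_locus :: "heis set \<Rightarrow> heis set" where
  "char_locus S = {g \<in> S. tangent_space S g = horizontal_plane g}"


section \<open>Horizontal mean curvature\<close>

definition W :: "(heis \<Rightarrow> real) \<Rightarrow> heis \<Rightarrow> real" where
  "W \<phi> g = sqrt ((vf_deriv X1 \<phi> g)\<^sup>2 + (vf_deriv X2 \<phi> g)\<^sup>2)"

definition pbar :: "(heis \<Rightarrow> real) \<Rightarrow> heis \<Rightarrow> real" where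
  "pbar \<phi> g = vf_deriv X1 \<phi> g / W \<phi> g"

definition qbar :: "(heis \<Rightarrow> real) \<Rightarrow> heis \<Rightarrow> real" where
  "qbar \<phi> g = vf_deriv X2 \<phi> g / W \<phi> g"

definition H_mean_curvature :: "(heis \<Rightarrow> real) \<Rightarrow> heis \<Rightarrow> real" where
  "H_mean_curvature \<phi> g = vf_deriv X1 (pbar \<phi>) g + vf_deriv X2 (qbar \<phi>) g"

text \<open>On a surface with empty characteristic locus the value of the curvature depends on the
  local defining function only up to sign; its vanishing is required here for every choice.\<close>

definition H_minimal :: "heis set \<Rightarrow> bool" where
  "H_minimal S \<longleftrightarrow> C2_surface S \<and> char_locus S = {} \<and>
     (\<forall>U \<phi>. local_defining_function S U \<phi> \<longrightarrow> (\<forall>g \<in> S \<inter> U. H_mean_curvature \<phi> g = 0))"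


section \<open>Graphical strips\<close>

definition strip1 :: "real set \<Rightarrow> (real \<Rightarrow> real) \<Rightarrow> heis set" where
  "strip1 I G = {(x, y, t) | x y t. t \<in> I \<and> x = y * G t}"

definition strip2 :: "real set \<Rightarrow> (real \<Rightarrow> real) \<Rightarrow> heis set" where
  "strip2 I G = {(x, y, t) | x y t. t \<in> I \<and> y = - x * G t}"

text \<open>Rotations about the t-axis are group automorphisms, so the maps
  \<open>hmult a \<circ> hrot \<theta>\<close> already form a group: neither the order of the two motions nor
  whether they act on the surface or on the model matters.\<close>

definition graphical_strip :: "heis set \<Rightarrow> bool" where
  "graphical_strip S \<longleftrightarrow> C2_surface S \<and>
     (\<exists>I G a \<theta>. open I \<and> is_interval I \<and> I \<noteq> {} \<and> C2_on G I \<and> (\<forall>t\<in>I. deriv G t \<ge> 0) \<and>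
        ((hmult a \<circ> hrot \<theta>) ` S = strip1 I G \<or> (hmult a \<circ> hrot \<theta>) ` S = strip2 I G))"


section \<open>Intrinsic graphs\<close>

definition intrinsic_X1_graph_on :: "(real \<times> real) set \<Rightarrow> heis set \<Rightarrow> bool" where
  "intrinsic_X1_graph_on \<Omega> S \<longleftrightarrow> (\<exists>\<phi>. C2_on \<phi> \<Omega> \<and>
     S = {hmult (0, u, v) (\<phi> (u, v), 0, 0) | u v. (u, v) \<in> \<Omega>})"

definition intrinsic_X2_graph_on :: "(real \<times> real) set \<Rightarrow> heis set \<Rightarrow> bool" where
  "intrinsic_X2_graph_on \<Omega> S \<longleftrightarrow> (\<exists>\<phi>. C2_on \<phi> \<Omega> \<and>
     S = {hmult (u, 0, v) (0, \<phi> (u, v), 0) | u v. (u, v) \<in> \<Omega>})"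

definition global_intrinsic_graph :: "heis set \<Rightarrow> bool" where
  "global_intrinsic_graph S \<longleftrightarrow> intrinsic_X1_graph_on UNIV S \<or> intrinsic_X2_graph_on UNIV S"

definition global_intrinsic_H_minimal_graph :: "heis set \<Rightarrow> bool" where
  "global_intrinsic_H_minimal_graph S \<longleftrightarrow> global_intrinsic_graph S \<and> H_minimal S"

end

theory Submission
  imports Defs
begin

text \<open>A strip is a union of horizontal lines \<open>s \<mapsto> g \<circ> (s a, s b, 0)\<close>, and the curves
  \<open>y = const\<close> (resp. \<open>x = const\<close>) in it have velocity on which the contact form is
  \<open>1 + y\<^sup>2 G' / 2 > 0\<close> (resp. \<open>1 + x\<^sup>2 G' / 2\<close>). Both properties are preserved by left translations and
  rotations. The second excludes characteristic points. By the first, \<open>(pbar, qbar)\<close> is, along each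
  ruling, a unit vector orthogonal to \<open>(a, b)\<close>; together with \<open>pbar\<^sup>2 + qbar\<^sup>2 = 1\<close> near the point
  this forces the curvature to vanish, whatever the defining function. If \<open>G\<close> is defined on the whole
  line, the point of the surface lying over the parameters \<open>(u, v)\<close> has the height \<open>t\<close> solving
  \<open>t + u\<^sup>2 G(t) / 2 = v\<close>, whose left-hand side is an expanding function of \<open>t\<close>.\<close>

section \<open>Functions of class C^1 and C^2\<close>

text \<open>The derivative is a map into bounded linear operators, continuous in operator norm.
  Arbitrary target spaces are allowed so that the notion applies again to derivatives.\<close>

definition C1_on :: "('a::real_normed_vector \<Rightarrow> 'b::real_normed_vector) \<Rightarrow> 'a set \<Rightarrow> bool" where
  "C1_on f U \<longleftrightarrow> (\<exists>f' :: 'a \<Rightarrow> 'a \<Rightarrow>\<^sub>L 'b.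
     (\<forall>x\<in>U. (f has_derivative blinfun_apply (f' x)) (at x)) \<and> continuous_on U f')"

lemma C1_onI:
  assumes "\<And>x. x \<in> U \<Longrightarrow> (f has_derivative blinfun_apply (f' x)) (at x)" "continuous_on U f'"
  shows "C1_on f U"
  unfolding C1_on_def using assms by (intro exI[of _ f']) auto

text \<open>This reduces second-order calculus to first order: each closure property of C2 functions
  follows from a derivative formula whose right-hand side is built by C1 operations.\<close>

lemma C2_on_iff_C1_derivative:
  "C2_on f U \<longleftrightarrow> open U \<and>
     (\<exists>f'. (\<forall>x\<in>U. (f has_derivative blinfun_apply (f' x)) (at x)) \<and> C1_on f' U)"
  unfolding C2_on_def C1_on_def by blast

lemma C1_on_imp_continuous_on: "C1_on f U \<Longrightarrow> continuous_on U f"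
  unfolding C1_on_def
  by (meson continuous_at_imp_continuous_on has_derivative_continuous)

lemma C1_on_bounded_linear:
  assumes "bounded_linear f"
  shows "C1_on f U"
  unfolding C1_on_def
  by (rule exI[of _ "\<lambda>_. Blinfun f"])
    (auto simp: bounded_linear_Blinfun_apply assms bounded_linear.has_derivative[OF assms])

lemma C1_on_const: "C1_on (\<lambda>_. c) U"
  unfolding C1_on_def by (rule exI[of _ "\<lambda>_. 0"]) (auto simp: zero_blinfun.rep_eq)

lemma C1_on_add:
  assumes "C1_on f U" "C1_on g U"
  shows "C1_on (\<lambda>x. f x + g x) U"
proof -
  obtain f' g' where "\<forall>x\<in>U. (f has_derivative blinfun_apply (f' x)) (at x)" "continuous_on U f'"
    "\<forall>x\<in>U. (g has_derivative blinfun_apply (g' x)) (at x)" "continuous_on U g'"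
    using assms unfolding C1_on_def by blast
  then show ?thesis
    unfolding C1_on_def
    by (intro exI[of _ "\<lambda>x. f' x + g' x"])
      (auto intro!: continuous_intros derivative_eq_intros simp: blinfun.add_left)
qed

text \<open>One product rule covers real products, scaling of operator-valued derivatives and
  evaluation of operators at vectors.\<close>

lemma (in bounded_bilinear) C1_on:
  fixes f :: "'d::real_normed_vector \<Rightarrow> 'a"
  assumes "C1_on f U" "C1_on g U"
  shows "C1_on (\<lambda>x. prod (f x) (g x)) U"
proof -
  obtain f' g' where f': "\<forall>x\<in>U. (f has_derivative blinfun_apply (f' x)) (at x)" "continuous_on U f'"
    and g': "\<forall>x\<in>U. (g has_derivative blinfun_apply (g' x)) (at x)" "continuous_on U g'"
    using assms unfolding C1_on_def by blast
  \<comment> \<open>The product rule, with the partially applied products as operators, so that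
    continuity of the derivative follows from that of operator composition.\<close>
  let ?D = "\<lambda>x. (prod_right (f x) o\<^sub>L g' x) + (prod_left (g x) o\<^sub>L f' x)"
  have "((\<lambda>x. prod (f x) (g x)) has_derivative blinfun_apply (?D x)) (at x)" if "x \<in> U" for x
    using FDERIV[of f "f' x" x UNIV g "g' x"] f' g' that by (simp add: plus_blinfun.rep_eq)
  moreover have "continuous_on U (\<lambda>x. prod_right (f x))" "continuous_on U (\<lambda>x. prod_left (g x))"
    using assms[THEN C1_on_imp_continuous_on] bounded_linear.continuous_on
      bounded_linear_prod_right bounded_linear_prod_left by blast+
  then have "continuous_on U ?D"
    using f'(2) g'(2) by (simp add: continuous_on_add bounded_bilinear.continuous_on[OF bounded_bilinear_blinfun_compose])
  ultimately show ?thesis by (rule C1_onI)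
qed

lemmas C1_on_mult = bounded_bilinear.C1_on[OF bounded_bilinear_mult]
lemmas C1_on_scaleR = bounded_bilinear.C1_on[OF bounded_bilinear_scaleR]
lemmas C1_on_blinfun_apply = bounded_bilinear.C1_on[OF bounded_bilinear_blinfun_apply]

lemma C1_on_compose:
  assumes "C1_on g V" "C1_on f U" "f ` U \<subseteq> V"
  shows "C1_on (\<lambda>x. g (f x)) U"
proof -
  obtain f' g' where f': "\<forall>x\<in>U. (f has_derivative blinfun_apply (f' x)) (at x)" "continuous_on U f'"
    and g': "\<forall>x\<in>V. (g has_derivative blinfun_apply (g' x)) (at x)" "continuous_on V g'"
    using assms unfolding C1_on_def by blast
  have "((\<lambda>x. g (f x)) has_derivative blinfun_apply (g' (f x) o\<^sub>L f' x)) (at x)" if "x \<in> U" for x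
    using has_derivative_compose[of f "f' x" x UNIV g "g' (f x)"] f' g' that assms(3)
    by (auto simp: blinfun_compose.rep_eq o_def)
  moreover have "continuous_on U (\<lambda>x. g' (f x) o\<^sub>L f' x)"
    using bounded_bilinear.continuous_on[OF bounded_bilinear_blinfun_compose
        continuous_on_compose2[OF g'(2) C1_on_imp_continuous_on[OF assms(2)] assms(3)] f'(2)] .
  ultimately show ?thesis by (rule C1_onI)
qed

lemma C1_on_inverse:
  fixes f :: "'a::real_normed_vector \<Rightarrow> real"
  assumes "C1_on f U" "\<And>x. x \<in> U \<Longrightarrow> f x \<noteq> 0"
  shows "C1_on (\<lambda>x. inverse (f x)) U"
proof -
  obtain f' where f': "\<forall>x\<in>U. (f has_derivative blinfun_apply (f' x)) (at x)" "continuous_on U f'"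
    using assms unfolding C1_on_def by blast
  have "((\<lambda>x. inverse (f x)) has_derivative blinfun_apply (- (inverse (f x))\<^sup>2 *\<^sub>R f' x)) (at x)"
    if "x \<in> U" for x
    using Deriv.has_derivative_inverse[OF assms(2) bspec[OF f'(1)], OF that that]
    by (auto simp: scaleR_blinfun.rep_eq uminus_blinfun.rep_eq power2_eq_square ac_simps)
  moreover have "continuous_on U (\<lambda>x. - (inverse (f x))\<^sup>2 *\<^sub>R f' x)"
    using f'(2) C1_on_imp_continuous_on[OF assms(1)] assms(2)
    by (intro continuous_intros) auto
  ultimately show ?thesis by (rule C1_onI)
qed

text \<open>Bridge between operator-valued derivatives and \<open>deriv\<close>, in which the sign
  condition on \<open>G\<close> is expressed: a linear functional on the line is multiplication by
  its value at 1.\<close>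

lemma C2_on_real_deriv:
  fixes G :: "real \<Rightarrow> real"
  assumes "C2_on G I"
  shows "t \<in> I \<Longrightarrow> (G has_real_derivative deriv G t) (at t)" "C1_on G I" "C1_on (deriv G) I"
proof -
  obtain G' where G': "open I" "\<forall>t\<in>I. (G has_derivative blinfun_apply (G' t)) (at t)" "C1_on G' I"
    using assms unfolding C2_on_iff_C1_derivative by blast
  have D: "(G has_real_derivative blinfun_apply (G' t) 1) (at t)" if "t \<in> I" for t
  proof -
    have "blinfun_apply (G' t) h = blinfun_apply (G' t) 1 * h" for h
      using blinfun.scaleR_right[of "G' t" h 1] by (simp add: mult.commute)
    then have "blinfun_apply (G' t) = (*) (blinfun_apply (G' t) 1)" by blast
    then show ?thesis using G'(2) that unfolding has_field_derivative_def by metis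
  qed
  then have eq: "deriv G t = blinfun_apply (G' t) 1" if "t \<in> I" for t
    using that by (simp add: DERIV_imp_deriv)
  show "(G has_real_derivative deriv G t) (at t)" if "t \<in> I"
    using D eq that by simp
  show "C1_on G I"
    using G'(2) C1_on_imp_continuous_on[OF G'(3)] by (intro C1_onI[where f' = G']) auto
  have "C1_on (\<lambda>t. blinfun_apply (G' t) 1) I"
    by (intro C1_on_blinfun_apply G' C1_on_const)
  then obtain D where D: "\<And>t. t \<in> I \<Longrightarrow> ((\<lambda>t. blinfun_apply (G' t) 1) has_derivative blinfun_apply (D t)) (at t)"
    "continuous_on I D"
    unfolding C1_on_def by blast
  \<comment> \<open>\<open>deriv G\<close> is known to agree with the evaluated operator only on
    \<open>I\<close>; openness of \<open>I\<close> lets the derivative be transferred.\<close>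
  have "(deriv G has_derivative blinfun_apply (D t)) (at t)" if "t \<in> I" for t
    using has_derivative_transform_within_open[OF D(1) G'(1)] eq that by simp
  then show "C1_on (deriv G) I"
    using D(2) by (rule C1_onI)
qed

section \<open>Closure properties of C2 functions\<close>

lemma C2_on_bounded_linear:
  assumes "bounded_linear f" "open U"
  shows "C2_on f U"
  unfolding C2_on_iff_C1_derivative
  by (intro conjI assms exI[of _ "\<lambda>_. Blinfun f"] C1_on_const)
    (auto simp: bounded_linear_Blinfun_apply assms bounded_linear.has_derivative[OF assms(1)])

lemma C2_on_add:
  assumes "C2_on f U" "C2_on g U"
  shows "C2_on (\<lambda>x. f x + g x) U"
proof -
  obtain f' g' where *: "open U"
    "\<forall>x\<in>U. (f has_derivative blinfun_apply (f' x)) (at x)" "C1_on f' U"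
    "\<forall>x\<in>U. (g has_derivative blinfun_apply (g' x)) (at x)" "C1_on g' U"
    using assms unfolding C2_on_iff_C1_derivative by blast
  have "((\<lambda>x. f x + g x) has_derivative blinfun_apply (f' x + g' x)) (at x)" if "x \<in> U" for x
    using has_derivative_add[of f "f' x" "at x" g "g' x"] * that by (simp add: plus_blinfun.rep_eq)
  then show ?thesis
    unfolding C2_on_iff_C1_derivative using *
    by (intro conjI exI[of _ "\<lambda>x. f' x + g' x"] C1_on_add) auto
qed

lemma C2_on_imp_C1_on: "C2_on f U \<Longrightarrow> C1_on f U"
  unfolding C2_on_iff_C1_derivative using C1_onI C1_on_imp_continuous_on by metis

lemma C2_on_mult:
  assumes "C2_on f U" "C2_on g U"
  shows "C2_on (\<lambda>x. f x * g x) U"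
proof -
  obtain f' g' where *: "open U"
    "\<forall>x\<in>U. (f has_derivative blinfun_apply (f' x)) (at x)" "C1_on f' U"
    "\<forall>x\<in>U. (g has_derivative blinfun_apply (g' x)) (at x)" "C1_on g' U"
    using assms unfolding C2_on_iff_C1_derivative by blast
  have "((\<lambda>x. f x * g x) has_derivative blinfun_apply (f x *\<^sub>R g' x + g x *\<^sub>R f' x)) (at x)"
    if "x \<in> U" for x
    using has_derivative_mult[of f "f' x" x UNIV g "g' x"] * that
    by (simp add: plus_blinfun.rep_eq scaleR_blinfun.rep_eq mult.commute)
  then show ?thesis
    unfolding C2_on_iff_C1_derivative using * assms[THEN C2_on_imp_C1_on]
    by (intro conjI exI[of _ "\<lambda>x. f x *\<^sub>R g' x + g x *\<^sub>R f' x"] C1_on_add C1_on_scaleR) auto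
qed

lemma C2_on_compose_real:
  fixes G :: "real \<Rightarrow> real"
  assumes "C2_on G I" "C2_on f U" "f ` U \<subseteq> I"
  shows "C2_on (\<lambda>x. G (f x)) U"
proof -
  obtain f' where *: "open U"
    "\<forall>x\<in>U. (f has_derivative blinfun_apply (f' x)) (at x)" "C1_on f' U"
    using assms unfolding C2_on_iff_C1_derivative by blast
  have "((\<lambda>x. G (f x)) has_derivative blinfun_apply (deriv G (f x) *\<^sub>R f' x)) (at x)"
    if "x \<in> U" for x
  proof -
    have "f x \<in> I" using that assms(3) by blast
    with * that have "((\<lambda>x. G (f x)) has_derivative (\<lambda>v. blinfun_apply (f' x) v * deriv G (f x))) (at x)"
      by (intro DERIV_compose_FDERIV[where f = G] C2_on_real_deriv(1)[OF assms(1)]) auto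
    then show ?thesis by (simp add: scaleR_blinfun.rep_eq mult.commute)
  qed
  then show ?thesis
    unfolding C2_on_iff_C1_derivative
    using * C1_on_compose[OF C2_on_real_deriv(3)[OF assms(1)] C2_on_imp_C1_on[OF assms(2)] assms(3)]
    by (intro conjI exI[of _ "\<lambda>x. deriv G (f x) *\<^sub>R f' x"] C1_on_scaleR) auto
qed

section \<open>Ruled surfaces transversal to the contact distribution\<close>

text \<open>The form \<open>dt - (x dy - y dx) / 2\<close>, whose kernel at each point is the
  horizontal plane.\<close>

fun contact_form :: "heis \<Rightarrow> heis \<Rightarrow> real" where
  "contact_form (x, y, t) (a, b, c) = c - (x * b - y * a) / 2"

text \<open>Rulings are right translates by \<open>(s * a, s * b, 0)\<close>, so a left translation
  maps them to rulings with the same direction \<open>(a, b)\<close>.\<close>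

definition horizontally_ruled :: "heis set \<Rightarrow> bool" where
  "horizontally_ruled S \<longleftrightarrow>
     (\<forall>g\<in>S. \<exists>a b. (a, b) \<noteq> (0, 0) \<and> (\<forall>s. hmult g (s * a, s * b, 0) \<in> S))"

text \<open>A single witness vector separates the tangent set from the horizontal plane, with no
  appeal to a linear structure on the tangent set, which is defined through curves.\<close>

definition contact_transversal :: "heis set \<Rightarrow> bool" where
  "contact_transversal S \<longleftrightarrow> (\<forall>g\<in>S. \<exists>v\<in>tangent_space S g. contact_form g v \<noteq> 0)"

lemma contact_form_horizontal:
  assumes "v \<in> horizontal_plane g"
  shows "contact_form g v = 0"
proof -
  obtain x y t where g: "g = (x, y, t)" by (cases g)
  have "subspace {v. contact_form g v = 0}"
    by (auto simp: subspace_def g zero_prod_def field_simps) (algebra+)?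
  moreover have "{X1 g, X2 g} \<subseteq> {v. contact_form g v = 0}"
    by (auto simp: g)
  ultimately have "v \<in> {v. contact_form g v = 0}"
    using assms span_minimal unfolding horizontal_plane_def by blast
  then show ?thesis by simp
qed

lemma contact_transversal_char_locus:
  "contact_transversal S \<Longrightarrow> char_locus S = {}"
  unfolding contact_transversal_def char_locus_def using contact_form_horizontal by blast

section \<open>Tangent vectors and local defining functions\<close>

lemma has_vector_derivative_chain:
  assumes "(\<gamma> has_vector_derivative v) (at s)" "(f has_derivative D) (at (\<gamma> s))"
  shows "((\<lambda>s. f (\<gamma> s)) has_vector_derivative D v) (at s)"
  using vector_derivative_diff_chain_within[OF assms(1) has_derivative_at_withinI[OF assms(2)]]
  by (simp add: o_def)

lemma has_vector_derivative_locally_0: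
  assumes "open N" "s \<in> N" "\<And>r. r \<in> N \<Longrightarrow> f r = 0" "(f has_vector_derivative v) (at s)"
  shows "v = 0"
  using vector_derivative_unique_at[OF
      has_vector_derivative_transform_within_open[where g = "\<lambda>_. 0", OF assms(4,1,2,3)]
      has_vector_derivative_const] .

text \<open>A curve in \<open>S\<close> through \<open>g\<close> stays in \<open>U\<close> for small
  parameters by continuity; there \<open>\<phi>\<close> vanishes along it, and so does its
  derivative.\<close>

lemma tangent_space_derivative_eq_0:
  assumes "v \<in> tangent_space S g" "local_defining_function S U \<phi>" "g \<in> U"
    and "(\<phi> has_derivative D) (at g)"
  shows "D v = 0"
proof -
  obtain \<epsilon> \<gamma> where *: "\<epsilon> > 0" "\<gamma> ` {-\<epsilon><..<\<epsilon>} \<subseteq> S" "\<gamma> 0 = g"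
    "(\<gamma> has_vector_derivative v) (at 0)"
    using assms(1) unfolding tangent_space_def by blast
  have U: "open U" "S \<inter> U = {g \<in> U. \<phi> g = 0}"
    using assms(2) unfolding local_defining_function_def C2_on_def by auto
  have "isCont \<gamma> 0" using *(4) has_vector_derivative_continuous by blast
  then have "(\<gamma> \<longlongrightarrow> g) (nhds 0)"
    using *(3) by (metis continuous_at tendsto_at_iff_tendsto_nhds)
  then have "\<forall>\<^sub>F s in nhds 0. \<gamma> s \<in> U"
    using topological_tendstoD U(1) assms(3) by blast
  moreover have "\<forall>\<^sub>F s in nhds 0. s \<in> {-\<epsilon><..<\<epsilon>}"
    using *(1) by (intro eventually_nhds_in_open) auto
  ultimately have ev: "\<forall>\<^sub>F s in nhds 0. 0 = \<phi> (\<gamma> s)"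
  proof eventually_elim
    case (elim s)
    then have "\<gamma> s \<in> S \<inter> U" using *(2) by auto
    then show ?case unfolding U(2) by simp
  qed
  then obtain N where "open N" "0 \<in> N" "\<And>s. s \<in> N \<Longrightarrow> \<phi> (\<gamma> s) = 0"
    unfolding eventually_nhds by fastforce
  then show ?thesis
    by (rule has_vector_derivative_locally_0[OF _ _ _ has_vector_derivative_chain[OF *(4)]])
      (use *(3) assms(4) in auto)
qed

text \<open>Packages \<open>frechet_derivative\<close> as a differentiable operator-valued map, so
  that \<open>vf_deriv X \<phi>\<close> becomes a bilinear expression to which the product rule
  applies.\<close>

lemma defining_function_derivative:
  assumes "local_defining_function S U \<phi>" "x \<in> U"
  defines "\<phi>' \<equiv> \<lambda>x. Blinfun (frechet_derivative \<phi> (at x))"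
  shows "(\<phi> has_derivative blinfun_apply (\<phi>' x)) (at x)"
    "frechet_derivative \<phi> (at x) = blinfun_apply (\<phi>' x)"
    "\<phi>' differentiable (at x)"
proof -
  obtain D D' where D: "\<forall>x\<in>U. (\<phi> has_derivative blinfun_apply (D x)) (at x)"
    and D': "\<forall>x\<in>U. (D has_derivative blinfun_apply (D' x)) (at x)" and U: "open U"
    using assms unfolding local_defining_function_def C2_on_def by blast
  have eq: "frechet_derivative \<phi> (at x) = blinfun_apply (D x)" if "x \<in> U" for x
    using frechet_derivative_at D that by metis
  then have \<phi>': "D x = \<phi>' x" if "x \<in> U" for x
    using that unfolding \<phi>'_def by (simp add: blinfun_apply_inverse)
  show "(\<phi> has_derivative blinfun_apply (\<phi>' x)) (at x)"
    "frechet_derivative \<phi> (at x) = blinfun_apply (\<phi>' x)"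
    using D eq \<phi>' assms(2) by auto
  show "\<phi>' differentiable (at x)"
    using has_derivative_transform_within_open[OF bspec[OF D' assms(2)] U assms(2) \<phi>']
    unfolding differentiable_def by blast
qed

text \<open>If \<open>W\<close> vanished, the derivative of \<open>\<phi>\<close> would kill
  \<open>X1\<close> and \<open>X2\<close> and hence be a multiple of the contact form. It also kills
  a tangent vector on which that form is nonzero, so it would be zero, against regularity of
  \<open>\<phi>\<close>.\<close>

lemma contact_transversal_W_neq_0:
  assumes "contact_transversal S" "local_defining_function S U \<phi>" "g \<in> S \<inter> U"
  shows "W \<phi> g \<noteq> 0"
proof
  assume "W \<phi> g = 0"
  then have X: "frechet_derivative \<phi> (at g) (X1 g) = 0" "frechet_derivative \<phi> (at g) (X2 g) = 0"
    unfolding W_def vf_deriv_def by (auto simp: sum_power2_eq_zero_iff)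
  define \<phi>' where "\<phi>' x = Blinfun (frechet_derivative \<phi> (at x))" for x
  note \<phi>' = defining_function_derivative[OF assms(2), folded \<phi>'_def]
  let ?L = "blinfun_apply (\<phi>' g)"
  obtain v where v: "v \<in> tangent_space S g" "contact_form g v \<noteq> 0"
    using assms unfolding contact_transversal_def by blast
  \<comment> \<open>Coordinates in the left-invariant frame \<open>X1\<close>, \<open>X2\<close>,
    \<open>T\<close>: the contact form is the coordinate along \<open>T\<close>.\<close>
  have decomp: "w = fst w *\<^sub>R X1 g + fst (snd w) *\<^sub>R X2 g + contact_form g w *\<^sub>R (0, 0, 1)" for w
    by (cases g; cases w) (auto simp: field_simps)
  have L: "?L w = contact_form g w * ?L (0, 0, 1)" for w
    using X \<phi>'(2)[of g] assms(3)
    by (subst decomp[of w]) (simp add: blinfun.bilinear_simps del: scaleR_Pair)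
  have "?L v = 0"
    using tangent_space_derivative_eq_0[OF v(1) assms(2)] \<phi>'(1) assms(3) by blast
  then have "?L (0, 0, 1) = 0" using L[of v] v(2) by simp
  then have "?L = (\<lambda>v. 0)" by (intro ext) (subst L, simp)
  moreover have gU: "g \<in> U" using assms(3) by blast
  moreover have "\<forall>g\<in>U. frechet_derivative \<phi> (at g) \<noteq> (\<lambda>v. 0)"
    using assms(2) unfolding local_defining_function_def by (elim conjE)
  ultimately show False
    using \<phi>'(2) by auto
qed

section \<open>Vanishing of the curvature along horizontal rulings\<close>

lemma X1_differentiable: "X1 differentiable (at g)"
proof -
  have 1: "X1 = (\<lambda>g::heis. (1, 0, - fst (snd g) / 2))" by (auto simp: fun_eq_iff)
  have 2: "((\<lambda>g::heis. (1, 0, - fst (snd g) / 2)) has_derivative (\<lambda>v. (0, 0, - fst (snd v) / 2))) (at g)"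
    by (auto intro!: has_derivative_Pair derivative_eq_intros)
  show ?thesis unfolding 1 by (rule differentiableI[OF 2])
qed

lemma X2_differentiable: "X2 differentiable (at g)"
proof -
  have 1: "X2 = (\<lambda>g::heis. (0, 1, fst g / 2))" by (auto simp: fun_eq_iff)
  have 2: "((\<lambda>g::heis. (0, 1, fst g / 2)) has_derivative (\<lambda>v. (0, 0, fst v / 2))) (at g)"
    by (auto intro!: has_derivative_Pair derivative_eq_intros)
  show ?thesis unfolding 1 by (rule differentiableI[OF 2])
qed

text \<open>The ruling is a Euclidean line with constant velocity, and by left invariance this
  velocity has the same coefficients \<open>a\<close>, \<open>b\<close> in the frame at all its
  points.\<close>

lemma horizontal_line_derivative:
  assumes "g = (x, y, t)"
  shows "((\<lambda>s. hmult g (s * a, s * b, 0)) has_vector_derivative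
    a *\<^sub>R X1 (hmult g (s * a, s * b, 0)) + b *\<^sub>R X2 (hmult g (s * a, s * b, 0))) (at s)"
proof -
  let ?w = "(a, b, (x * b - a * y) / 2)"
  have "(\<lambda>s. hmult g (s * a, s * b, 0)) = (\<lambda>s. g + s *\<^sub>R ?w)"
    by (auto simp: assms field_simps)
  moreover have "((\<lambda>s. g + s *\<^sub>R ?w) has_vector_derivative ?w) (at s)"
    unfolding has_vector_derivative_def by (intro derivative_eq_intros) auto
  moreover have "a *\<^sub>R X1 (hmult g (s * a, s * b, 0)) + b *\<^sub>R X2 (hmult g (s * a, s * b, 0)) = ?w"
    by (auto simp: assms field_simps)
  ultimately show ?thesis by simp
qed

text \<open>Here \<open>(v\<^sub>1, v\<^sub>2)\<close> and \<open>(w\<^sub>1, w\<^sub>2)\<close> are the derivatives of \<open>pbar\<close> and \<open>qbar\<close> along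
  \<open>(X1, X2)\<close>.\<close>

lemma trace_eq_0:
  fixes a b p q :: real
  assumes "a * p + b * q = 0" "p\<^sup>2 + q\<^sup>2 = 1" "a\<^sup>2 + b\<^sup>2 \<noteq> 0"
    and "a * (a * v1 + b * v2) + b * (a * w1 + b * w2) = 0"
    and "p * v1 + q * w1 = 0" "p * v2 + q * w2 = 0"
  shows "v1 + w2 = 0"
proof -
  \<comment> \<open>Being orthogonal to the unit vector \<open>(p, q)\<close>, the vector
    \<open>(a, b)\<close> is \<open>k\<close> times its quarter turn
    \<open>(- q, p)\<close>.\<close>
  define k where "k = b * p - a * q"
  have a: "a = - k * q" and b: "b = k * p"
    using assms(1,2) unfolding k_def by algebra+
  have "k \<noteq> 0" using a b assms(3) by auto
  \<comment> \<open>In the relation along the ruling, the last two hypotheses turn the mixed terms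
    \<open>p * q * v2\<close> and \<open>p * q * w1\<close> into \<open>- q^2 * w2\<close> and
    \<open>- p^2 * v1\<close>; what remains is \<open>k^2 * (p^2 + q^2) * (v1 + w2)\<close>.\<close>
  have "k\<^sup>2 * (v1 + w2) = 0"
    using assms(2,4-6) unfolding a b by algebra
  with \<open>k \<noteq> 0\<close> show ?thesis by simp
qed

text \<open>Differentiating the unit-length identity along \<open>X1\<close> and \<open>X2\<close>,
  and the orthogonality to \<open>(a, b)\<close> along the ruling, gives three linear relations
  between the four derivatives of \<open>pbar\<close> and \<open>qbar\<close>. They determine the
  sum that is the curvature.\<close>

lemma ruled_H_mean_curvature_eq_0:
  assumes \<phi>: "local_defining_function S U \<phi>" and g: "g \<in> S \<inter> U" and W: "W \<phi> g \<noteq> 0"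
    and ab: "(a, b) \<noteq> (0, 0)" and line: "\<And>s. hmult g (s * a, s * b, 0) \<in> S"
  shows "H_mean_curvature \<phi> g = 0"
proof -
  define \<phi>' where "\<phi>' x = Blinfun (frechet_derivative \<phi> (at x))" for x
  note \<phi>' = defining_function_derivative[OF \<phi>, folded \<phi>'_def]
  have U: "open U" "S \<inter> U = {g \<in> U. \<phi> g = 0}"
    using \<phi> unfolding local_defining_function_def C2_on_def by auto
  have diff: "vf_deriv X \<phi> differentiable at g" if "X differentiable at g" for X
  proof -
    from that \<phi>'(3)[of g] g obtain A B where
      "(X has_derivative A) (at g)" "(\<phi>' has_derivative B) (at g)"
      unfolding differentiable_def by blast
    from blinfun.FDERIV[OF this(2,1)]
    have "((\<lambda>h. blinfun_apply (\<phi>' h) (X h)) has_derivative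
        (\<lambda>h. blinfun_apply (\<phi>' g) (A h) + blinfun_apply (B h) (X g))) (at g)" .
    then have "(vf_deriv X \<phi> has_derivative
        (\<lambda>h. blinfun_apply (\<phi>' g) (A h) + blinfun_apply (B h) (X g))) (at g)"
      by (rule has_derivative_transform_within_open[OF _ U(1)])
        (use g \<phi>'(2) in \<open>auto simp: vf_deriv_def\<close>)
    then show ?thesis
      unfolding differentiable_def by blast
  qed
  have P: "vf_deriv X1 \<phi> differentiable at g" and Q: "vf_deriv X2 \<phi> differentiable at g"
    using diff X1_differentiable X2_differentiable by blast+
  have W_diff: "W \<phi> differentiable at g"
  proof -
    let ?R = "\<lambda>g. (vf_deriv X1 \<phi> g)\<^sup>2 + (vf_deriv X2 \<phi> g)\<^sup>2"
    have "?R g \<noteq> 0" using W unfolding W_def by auto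
    then have "?R g > 0" by (metis not_sum_power2_lt_zero less_linear)
    moreover have "?R differentiable at g" using P Q by simp
    then obtain D where "(?R has_derivative D) (at g)" unfolding differentiable_def by blast
    ultimately have "((\<lambda>g. sqrt (?R g)) has_derivative (\<lambda>h. D h * (inverse (sqrt (?R g)) / 2))) (at g)"
      by (rule has_derivative_real_sqrt)
    then show ?thesis unfolding differentiable_def W_def[abs_def] by blast
  qed
  define Dp Dq where "Dp = frechet_derivative (pbar \<phi>) (at g)" and "Dq = frechet_derivative (qbar \<phi>) (at g)"
  have Dp: "(pbar \<phi> has_derivative Dp) (at g)" and Dq: "(qbar \<phi> has_derivative Dq) (at g)"
    unfolding Dp_def Dq_def frechet_derivative_works[symmetric] pbar_def[abs_def] qbar_def[abs_def]
    using P Q W_diff W by (auto intro: differentiable_divide)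
  let ?p = "pbar \<phi> g" and ?q = "qbar \<phi> g"
  have "\<forall>\<^sub>F h in nhds g. W \<phi> h \<noteq> 0"
  proof -
    have "(W \<phi> \<longlongrightarrow> W \<phi> g) (nhds g)"
      using differentiable_imp_continuous_within[OF W_diff]
      by (metis continuous_at tendsto_at_iff_tendsto_nhds)
    then show ?thesis using W tendsto_imp_eventually_ne by blast
  qed
  then obtain V where V: "open V" "g \<in> V" "\<And>h. h \<in> V \<Longrightarrow> W \<phi> h \<noteq> 0"
    unfolding eventually_nhds by blast
  \<comment> \<open>Where \<open>W\<close> is zero both quotients are zero by convention and the
    identity fails, hence the restriction to \<open>V\<close>.\<close>
  have unit: "(pbar \<phi> h)\<^sup>2 + (qbar \<phi> h)\<^sup>2 = 1" if "h \<in> V" for h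
    using V(3)[OF that] unfolding pbar_def qbar_def power_divide add_divide_distrib[symmetric]
    by (auto simp: W_def)
  have "((\<lambda>h. (pbar \<phi> h)\<^sup>2 + (qbar \<phi> h)\<^sup>2) has_derivative (\<lambda>v. 2 * (?p * Dp v + ?q * Dq v))) (at g)"
    by (auto intro!: derivative_eq_intros Dp Dq simp: field_simps)
  moreover have "((\<lambda>h. (pbar \<phi> h)\<^sup>2 + (qbar \<phi> h)\<^sup>2) has_derivative (\<lambda>v. 0)) (at g)"
    by (rule has_derivative_transform_within_open[OF has_derivative_const[of 1] V(1,2)])
      (simp add: unit)
  ultimately have "(\<lambda>v. 2 * (?p * Dp v + ?q * Dq v)) = (\<lambda>v. 0)"
    by (rule has_derivative_unique)
  then have orth: "?p * Dp v + ?q * Dq v = 0" for v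
    by (drule_tac fun_cong[of _ _ v]) simp

  define \<gamma> where "\<gamma> s = hmult g (s * a, s * b, 0)" for s
  define w where "w = a *\<^sub>R X1 g + b *\<^sub>R X2 g"
  have \<gamma>': "(\<gamma> has_vector_derivative a *\<^sub>R X1 (\<gamma> s) + b *\<^sub>R X2 (\<gamma> s)) (at s)" for s
    unfolding \<gamma>_def by (cases g) (rule horizontal_line_derivative)
  have \<gamma>0: "\<gamma> 0 = g" unfolding \<gamma>_def by (cases g) auto
  \<comment> \<open>The ruling may leave \<open>U\<close>, so identities along it are available only
    on this open parameter set.\<close>
  have open_preimage: "open (\<gamma> -` U)"
    using \<gamma>' U(1) has_vector_derivative_continuous
    by (intro open_vimage continuous_at_imp_continuous_on) blast+
  have conormal: "a * pbar \<phi> (\<gamma> s) + b * qbar \<phi> (\<gamma> s) = 0" if "s \<in> \<gamma> -` U" for s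
  proof -
    let ?D = "blinfun_apply (\<phi>' (\<gamma> s))"
    have D: "((\<lambda>s. \<phi> (\<gamma> s)) has_vector_derivative ?D (a *\<^sub>R X1 (\<gamma> s) + b *\<^sub>R X2 (\<gamma> s))) (at s)"
      using has_vector_derivative_chain[OF \<gamma>' \<phi>'(1)] that by auto
    have "\<phi> (\<gamma> r) = 0" if "r \<in> \<gamma> -` U" for r
      using that U(2) line \<gamma>_def by auto
    from has_vector_derivative_locally_0[OF open_preimage that this D]
    have "?D (a *\<^sub>R X1 (\<gamma> s) + b *\<^sub>R X2 (\<gamma> s)) = 0" .
    then have "a * vf_deriv X1 \<phi> (\<gamma> s) + b * vf_deriv X2 \<phi> (\<gamma> s) = 0"
      using \<phi>'(2) that unfolding vf_deriv_def by (simp add: blinfun.bilinear_simps)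
    \<comment> \<open>The common numerator over \<open>W\<close> is zero, so the quotient is zero
      whatever the value of \<open>W\<close>.\<close>
    then show ?thesis
      unfolding pbar_def qbar_def by (simp flip: add_divide_distrib)
  qed
  have "((\<lambda>s. a * pbar \<phi> (\<gamma> s) + b * qbar \<phi> (\<gamma> s)) has_vector_derivative a * Dp w + b * Dq w) (at 0)"
  proof -
    have "((\<lambda>h. a * pbar \<phi> h + b * qbar \<phi> h) has_derivative (\<lambda>v. a * Dp v + b * Dq v)) (at (\<gamma> 0))"
      unfolding \<gamma>0 by (intro derivative_intros Dp Dq)
    from has_vector_derivative_chain[OF \<gamma>' this] show ?thesis
      by (simp only: \<gamma>0 w_def)
  qed
  then have along: "a * Dp w + b * Dq w = 0"
    by (rule has_vector_derivative_locally_0[OF open_preimage _ conormal, rotated -1])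
      (use \<gamma>0 g in auto)
  have lin: "Dp w = a * Dp (X1 g) + b * Dp (X2 g)" "Dq w = a * Dq (X1 g) + b * Dq (X2 g)"
    unfolding w_def using has_derivative_linear[OF Dp] has_derivative_linear[OF Dq]
    by (auto simp: linear_add linear_scale)
  have "a * ?p + b * ?q = 0" "?p\<^sup>2 + ?q\<^sup>2 = 1"
    using conormal[of 0] \<gamma>0 g unit V(2) by auto
  moreover have "a\<^sup>2 + b\<^sup>2 \<noteq> 0" using ab by (auto simp: sum_power2_eq_zero_iff)
  ultimately have "Dp (X1 g) + Dq (X2 g) = 0"
    using trace_eq_0[OF _ _ _ along[unfolded lin] orth[of "X1 g"] orth[of "X2 g"]] by blast
  then show ?thesis
    unfolding H_mean_curvature_def vf_deriv_def Dp_def Dq_def .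
qed

text \<open>Ruling and transversality are conditions on the set \<open>S\<close> alone, which is why
  every local defining function can be treated at once.\<close>

lemma ruled_transversal_H_minimal:
  assumes "C2_surface S" "horizontally_ruled S" "contact_transversal S"
  shows "H_minimal S"
  unfolding H_minimal_def
proof (intro conjI allI impI ballI)
  fix U \<phi> g
  assume \<phi>: "local_defining_function S U \<phi>" and g: "g \<in> S \<inter> U"
  then obtain a b where "(a, b) \<noteq> (0, 0)" "\<And>s. hmult g (s * a, s * b, 0) \<in> S"
    using assms(2) unfolding horizontally_ruled_def by blast
  then show "H_mean_curvature \<phi> g = 0"
    using ruled_H_mean_curvature_eq_0[OF \<phi> g contact_transversal_W_neq_0[OF assms(3) \<phi> g]] by blast
qed (use assms contact_transversal_char_locus in auto)

section \<open>Invariance under left translations and rotations\<close>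

lemma tangent_space_affine_image:
  assumes "bounded_linear L" "v \<in> tangent_space S g"
  shows "L v \<in> tangent_space ((\<lambda>x. c + L x) ` S) (c + L g)"
proof -
  let ?F = "\<lambda>x. c + L x"
  obtain \<epsilon> \<gamma> where *: "\<epsilon> > 0" "\<gamma> C1_differentiable_on {-\<epsilon><..<\<epsilon>}"
    "\<gamma> ` {-\<epsilon><..<\<epsilon>} \<subseteq> S" "\<gamma> 0 = g" "(\<gamma> has_vector_derivative v) (at 0)"
    using assms(2) unfolding tangent_space_def by blast
  obtain D where D: "\<forall>s\<in>{-\<epsilon><..<\<epsilon>}. (\<gamma> has_vector_derivative D s) (at s)"
    "continuous_on {-\<epsilon><..<\<epsilon>} D"
    using *(2) unfolding C1_differentiable_on_def by blast
  have deriv: "((\<lambda>s. ?F (\<gamma> s)) has_vector_derivative L w) (at s)"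
    if "(\<gamma> has_vector_derivative w) (at s)" for w s
    using has_vector_derivative_add[OF has_vector_derivative_const bounded_linear.has_vector_derivative[OF assms(1) that]]
    by simp
  have "(\<lambda>s. ?F (\<gamma> s)) C1_differentiable_on {-\<epsilon><..<\<epsilon>}"
    unfolding C1_differentiable_on_def
    using D deriv bounded_linear.continuous_on[OF assms(1) D(2)]
    by (intro exI[of _ "\<lambda>s. L (D s)"]) auto
  then show ?thesis
    unfolding tangent_space_def using * deriv[OF *(5)]
    by (auto intro!: exI[of _ \<epsilon>] exI[of _ "\<lambda>s. ?F (\<gamma> s)"])
qed

text \<open>Both kinds of motion are affine in coordinates and preserve the contact form, so the
  linear part carries a witness vector to a witness vector.\<close>

lemma contact_transversal_image:
  assumes "bounded_linear L" "\<And>g v. contact_form (c + L g) (L v) = contact_form g v"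
    and "contact_transversal S"
  shows "contact_transversal ((\<lambda>x. c + L x) ` S)"
  unfolding contact_transversal_def
proof
  fix h assume "h \<in> (\<lambda>x. c + L x) ` S"
  then obtain g v where "h = c + L g" "v \<in> tangent_space S g" "contact_form g v \<noteq> 0"
    using assms(3) unfolding contact_transversal_def by blast
  then show "\<exists>v\<in>tangent_space ((\<lambda>x. c + L x) ` S) h. contact_form h v \<noteq> 0"
    using tangent_space_affine_image[OF assms(1)] assms(2) by (intro bexI[of _ "L v"]) auto
qed

lemma hmult_invariance:
  shows "contact_transversal S \<Longrightarrow> contact_transversal (hmult a ` S)"
    and "horizontally_ruled S \<Longrightarrow> horizontally_ruled (hmult a ` S)"
proof -
  obtain x y t where a: "a = (x, y, t)" by (cases a)
  \<comment> \<open>The linear part of left translation by \<open>a\<close>; its last component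
    contains the bilinear term of the group law.\<close>
  define L :: "heis \<Rightarrow> heis" where
    "L g = (fst g, fst (snd g), snd (snd g) + (x * fst (snd g) - fst g * y) / 2)" for g
  have "bounded_linear L"
    unfolding linear_conv_bounded_linear[symmetric] L_def
    by (rule linearI) (auto simp: field_simps)
  moreover have "contact_form (a + L g) (L v) = contact_form g v" for g v
    by (cases g; cases v) (auto simp: a L_def field_simps)
  moreover have "hmult a = (\<lambda>g. a + L g)"
    by (auto simp: a L_def fun_eq_iff)
  ultimately show "contact_transversal S \<Longrightarrow> contact_transversal (hmult a ` S)"
    using contact_transversal_image[of L a S] by simp
  have assoc: "hmult a (hmult g w) = hmult (hmult a g) w" for g w
    by (cases g; cases w) (auto simp: a field_simps)
  show "horizontally_ruled (hmult a ` S)" if S: "horizontally_ruled S"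
    unfolding horizontally_ruled_def
  proof
    fix h assume "h \<in> hmult a ` S"
    then obtain g b c where "h = hmult a g" "(b, c) \<noteq> (0, 0)" "\<And>s. hmult g (s * b, s * c, 0) \<in> S"
      using S unfolding horizontally_ruled_def by blast
    then show "\<exists>b c. (b, c) \<noteq> (0, 0) \<and> (\<forall>s. hmult h (s * b, s * c, 0) \<in> hmult a ` S)"
      by (intro exI[of _ b] exI[of _ c]) (simp flip: assoc)
  qed
qed

lemma hrot_invariance:
  shows "contact_transversal S \<Longrightarrow> contact_transversal (hrot \<theta> ` S)"
    and "horizontally_ruled S \<Longrightarrow> horizontally_ruled (hrot \<theta> ` S)"
proof -
  have "bounded_linear (hrot \<theta>)"
    unfolding linear_conv_bounded_linear[symmetric]
    by (rule linearI) (auto simp: field_simps)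
  moreover have "contact_form (0 + hrot \<theta> g) (hrot \<theta> v) = contact_form g v" for g v
  proof -
    obtain x y t a b c where "g = (x, y, t)" "v = (a, b, c)" by (cases g; cases v)
    moreover have "(x * cos \<theta> - y * sin \<theta>) * (a * sin \<theta> + b * cos \<theta>) -
        (x * sin \<theta> + y * cos \<theta>) * (a * cos \<theta> - b * sin \<theta>) = x * b - y * a"
      using sin_cos_squared_add[of \<theta>] by algebra
    ultimately show ?thesis by simp
  qed
  ultimately show "contact_transversal S \<Longrightarrow> contact_transversal (hrot \<theta> ` S)"
    using contact_transversal_image[of "hrot \<theta>" 0 S] by simp
  show "horizontally_ruled (hrot \<theta> ` S)" if S: "horizontally_ruled S"
    unfolding horizontally_ruled_def
  proof
    fix g assume "g \<in> hrot \<theta> ` S"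
    then obtain g' where g': "g' \<in> S" "g = hrot \<theta> g'" by blast
    then obtain a b where ab: "(a, b) \<noteq> (0, 0)" "\<And>s. hmult g' (s * a, s * b, 0) \<in> S"
      using S unfolding horizontally_ruled_def by blast
    \<comment> \<open>The rotated direction: \<open>hrot \<theta>\<close> is a group homomorphism,
      so it maps the ruling in direction \<open>(a, b)\<close> to one in direction
      \<open>(a', b')\<close>.\<close>
    define a' b' where "a' = a * cos \<theta> - b * sin \<theta>" and "b' = a * sin \<theta> + b * cos \<theta>"
    have "a'\<^sup>2 + b'\<^sup>2 = a\<^sup>2 + b\<^sup>2"
      using sin_cos_squared_add[of \<theta>] unfolding a'_def b'_def by algebra
    then have "(a', b') \<noteq> (0, 0)" using ab(1) by (auto simp: sum_power2_eq_zero_iff)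
    moreover have "hmult g (s * a', s * b', 0) = hrot \<theta> (hmult g' (s * a, s * b, 0))" for s
    proof -
      obtain x y t where xyt: "g' = (x, y, t)" by (cases g')
      have eq: "(x * cos \<theta> - y * sin \<theta>) * (s * b') - (s * a') * (x * sin \<theta> + y * cos \<theta>) =
          x * (s * b) - (s * a) * y"
        using sin_cos_squared_add[of \<theta>] unfolding a'_def b'_def by algebra
      show ?thesis
        unfolding g'(2) xyt
        by (simp only: hmult.simps hrot.simps prod.inject eq) (simp add: a'_def b'_def algebra_simps)
    qed
    ultimately show "\<exists>a b. (a, b) \<noteq> (0, 0) \<and> (\<forall>s. hmult g (s * a, s * b, 0) \<in> hrot \<theta> ` S)"
      using ab(2) by blast
  qed
qed

text \<open>A graphical strip is moved onto its model; the inverse motion brings the properties of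
  the model back.\<close>

lemma isometry_inverse:
  "hrot (- \<theta>) (hmult (- a) ((hmult a \<circ> hrot \<theta>) g)) = g"
proof -
  have "hmult (- a) (hmult a h) = h" for h
    by (cases a; cases h) (auto simp: field_simps)
  moreover have "hrot (- \<theta>) (hrot \<theta> h) = h" for h
  proof -
    obtain x y t where h: "h = (x, y, t)" by (cases h)
    have "(x * cos \<theta> - y * sin \<theta>) * cos \<theta> + (x * sin \<theta> + y * cos \<theta>) * sin \<theta> = x"
      "(x * sin \<theta> + y * cos \<theta>) * cos \<theta> - (x * cos \<theta> - y * sin \<theta>) * sin \<theta> = y"
      using sin_cos_squared_add[of \<theta>] by algebra+
    then show ?thesis unfolding h by (simp add: algebra_simps)
  qed
  ultimately show ?thesis by simp
qed

section \<open>Strips\<close>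

text \<open>The slice at height \<open>t\<close> is a line through the t-axis. Its direction
  \<open>(G t, 1)\<close> is parallel to the position, so the bilinear term of the group law
  vanishes and the ruling stays at height \<open>t\<close>.\<close>

lemma horizontally_ruled_strip1: "horizontally_ruled (strip1 I G)"
  unfolding horizontally_ruled_def
proof
  fix g assume "g \<in> strip1 I G"
  then obtain y t where g: "g = (y * G t, y, t)" "t \<in> I" unfolding strip1_def by auto
  have "hmult g (s * G t, s * 1, 0) \<in> strip1 I G" for s
    using g unfolding strip1_def by (auto simp: algebra_simps)
  then show "\<exists>a b. (a, b) \<noteq> (0, 0) \<and> (\<forall>s. hmult g (s * a, s * b, 0) \<in> strip1 I G)"
    by (intro exI[of _ "G t"] exI[of _ 1]) auto
qed

lemma horizontally_ruled_strip2: "horizontally_ruled (strip2 I G)"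
  unfolding horizontally_ruled_def
proof
  fix g assume "g \<in> strip2 I G"
  then obtain x t where g: "g = (x, - x * G t, t)" "t \<in> I" unfolding strip2_def by auto
  have "hmult g (s * 1, s * - G t, 0) \<in> strip2 I G" for s
    using g unfolding strip2_def by (auto simp: algebra_simps)
  then show "\<exists>a b. (a, b) \<noteq> (0, 0) \<and> (\<forall>s. hmult g (s * a, s * b, 0) \<in> strip2 I G)"
    by (intro exI[of _ 1] exI[of _ "- G t"]) auto
qed

text \<open>The curve is parametrized by height. The coefficients \<open>p\<close>, \<open>q\<close>
  let one lemma serve both strips: \<open>(y, 0)\<close> for the first and \<open>(0, - x)\<close>
  for the second.\<close>

lemma strip_curve_tangent:
  assumes G: "C2_on G I" and t: "t \<in> I"
    and S: "\<And>r. r \<in> I \<Longrightarrow> (x + p * G r, y + q * G r, r) \<in> S"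
  shows "(p * deriv G t, q * deriv G t, 1) \<in> tangent_space S (x + p * G t, y + q * G t, t)"
proof -
  have I: "open I" using G unfolding C2_on_def by blast
  then obtain \<epsilon> where \<epsilon>: "\<epsilon> > 0" "ball t \<epsilon> \<subseteq> I" using t open_contains_ball by blast
  then have I\<epsilon>: "t + s \<in> I" if "s \<in> {-\<epsilon><..<\<epsilon>}" for s
    using that by (auto simp: dist_real_def subset_iff)
  define \<gamma> :: "real \<Rightarrow> heis" where "\<gamma> s = (x, y, t) + s *\<^sub>R (0, 0, 1) + G (t + s) *\<^sub>R (p, q, 0)" for s
  define D :: "real \<Rightarrow> heis" where "D s = (0, 0, 1) + deriv G (t + s) *\<^sub>R (p, q, 0)" for s
  have \<gamma>': "(\<gamma> has_vector_derivative D s) (at s)" if "s \<in> {-\<epsilon><..<\<epsilon>}" for s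
  proof -
    have "((\<lambda>s. G (t + s)) has_real_derivative deriv G (t + s)) (at s)"
      using DERIV_shift[of G "deriv G (t + s)" s t] C2_on_real_deriv(1)[OF G I\<epsilon>[OF that]]
      by (simp add: add.commute)
    then show ?thesis
      unfolding \<gamma>_def D_def has_vector_derivative_def has_field_derivative_def
      by (auto intro!: derivative_eq_intros simp: algebra_simps simp del: scaleR_Pair)
  qed
  have "continuous_on {-\<epsilon><..<\<epsilon>} (\<lambda>s. deriv G (t + s))"
    by (rule continuous_on_compose2[OF C1_on_imp_continuous_on[OF C2_on_real_deriv(3)[OF G]]])
      (auto intro!: continuous_intros I\<epsilon>)
  then have "continuous_on {-\<epsilon><..<\<epsilon>} D"
    unfolding D_def by (intro continuous_intros)
  with \<gamma>' have "\<gamma> C1_differentiable_on {-\<epsilon><..<\<epsilon>}"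
    unfolding C1_differentiable_on_def by blast
  moreover have "\<gamma> ` {-\<epsilon><..<\<epsilon>} \<subseteq> S"
    using S I\<epsilon> by (auto simp: \<gamma>_def mult.commute)
  moreover have "\<gamma> 0 = (x + p * G t, y + q * G t, t)"
    by (simp add: \<gamma>_def mult.commute)
  moreover have "(\<gamma> has_vector_derivative (p * deriv G t, q * deriv G t, 1)) (at 0)"
    using \<gamma>'[of 0] \<epsilon>(1) by (simp add: D_def mult.commute)
  ultimately show ?thesis
    unfolding tangent_space_def using \<epsilon>(1) by blast
qed

text \<open>The sign of \<open>deriv G\<close> enters here: it keeps the contact form at least 1 on
  the velocity of the curve with constant \<open>y\<close>.\<close>

lemma contact_transversal_strip1:
  assumes "C2_on G I" "\<forall>t\<in>I. deriv G t \<ge> 0"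
  shows "contact_transversal (strip1 I G)"
  unfolding contact_transversal_def
proof
  fix g assume "g \<in> strip1 I G"
  then obtain y t where g: "g = (y * G t, y, t)" "t \<in> I" unfolding strip1_def by auto
  have "(y * deriv G t, 0, 1) \<in> tangent_space (strip1 I G) g"
    using strip_curve_tangent[OF assms(1) g(2), of 0 y y 0 "strip1 I G"] g
    by (auto simp: strip1_def)
  moreover have "contact_form g (y * deriv G t, 0, 1) = 1 + y\<^sup>2 * deriv G t / 2"
    by (simp add: g power2_eq_square)
  moreover have "y\<^sup>2 * deriv G t \<ge> 0" using assms(2) g(2) by simp
  ultimately show "\<exists>v\<in>tangent_space (strip1 I G) g. contact_form g v \<noteq> 0" by force
qed

lemma contact_transversal_strip2:
  assumes "C2_on G I" "\<forall>t\<in>I. deriv G t \<ge> 0"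
  shows "contact_transversal (strip2 I G)"
  unfolding contact_transversal_def
proof
  fix g assume "g \<in> strip2 I G"
  then obtain x t where g: "g = (x, - x * G t, t)" "t \<in> I" unfolding strip2_def by auto
  have "(0, - x * deriv G t, 1) \<in> tangent_space (strip2 I G) g"
    using strip_curve_tangent[OF assms(1) g(2), of x 0 0 "- x" "strip2 I G"] g
    by (auto simp: strip2_def)
  moreover have "contact_form g (0, - x * deriv G t, 1) = 1 + x\<^sup>2 * deriv G t / 2"
    by (simp add: g power2_eq_square)
  moreover have "x\<^sup>2 * deriv G t \<ge> 0" using assms(2) g(2) by simp
  ultimately show "\<exists>v\<in>tangent_space (strip2 I G) g. contact_form g v \<noteq> 0" by force
qed

lemma graphical_strip_H_minimal:
  assumes "graphical_strip S"
  shows "H_minimal S"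
proof -
  obtain I G a \<theta> where G: "C2_on G I" "\<forall>t\<in>I. deriv G t \<ge> 0"
    and M: "(hmult a \<circ> hrot \<theta>) ` S = strip1 I G \<or> (hmult a \<circ> hrot \<theta>) ` S = strip2 I G"
    using assms unfolding graphical_strip_def by blast
  let ?M = "(hmult a \<circ> hrot \<theta>) ` S"
  have S: "S = hrot (- \<theta>) ` hmult (- a) ` ?M"
    by (simp only: image_image isometry_inverse image_ident)
  have "horizontally_ruled ?M" "contact_transversal ?M"
    using M horizontally_ruled_strip1 horizontally_ruled_strip2
      contact_transversal_strip1[OF G] contact_transversal_strip2[OF G] by metis+
  then have "horizontally_ruled S" "contact_transversal S"
    using hmult_invariance hrot_invariance S by metis+
  moreover have "C2_surface S" using assms unfolding graphical_strip_def by blast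
  ultimately show ?thesis using ruled_transversal_H_minimal by blast
qed

text \<open>Covers both strips, with \<open>(l, m)\<close> equal to \<open>(x, - y)\<close> or
  \<open>(y, x)\<close>. The direction \<open>v\<close> is chosen so that the term with
  \<open>G\<close> does not contribute and the derivative there is 1, which makes the level set
  regular with one global chart.\<close>

lemma C2_surface_level_set:
  fixes l m :: "heis \<Rightarrow> real"
  assumes G: "C2_on G UNIV" and lin: "bounded_linear l" "bounded_linear m"
    and v: "l v = 1" "m v = 0" "snd (snd v) = 0"
  shows "C2_surface {g. l g + m g * G (snd (snd g)) = 0}" (is "C2_surface {g. ?\<phi> g = 0}")
proof -
  have "bounded_linear (\<lambda>g::heis. snd (snd g))"
    using bounded_linear_compose[OF bounded_linear_snd bounded_linear_snd] .
  then have C2: "C2_on ?\<phi> UNIV"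
    using lin by (intro C2_on_add C2_on_mult C2_on_compose_real[OF G] C2_on_bounded_linear) auto
  have "frechet_derivative ?\<phi> (at g) \<noteq> (\<lambda>v. 0)" for g
  proof -
    have "((\<lambda>g::heis. G (snd (snd g))) has_derivative (\<lambda>v. snd (snd v) * deriv G (snd (snd g)))) (at g)"
      by (rule DERIV_compose_FDERIV[OF C2_on_real_deriv(1)[OF G]]) (auto intro!: derivative_intros)
    then have "(?\<phi> has_derivative (\<lambda>v. l v + (m g * (snd (snd v) * deriv G (snd (snd g))) + m v * G (snd (snd g))))) (at g)"
      using lin by (intro has_derivative_add has_derivative_mult bounded_linear_imp_has_derivative)
    from frechet_derivative_at[OF this, symmetric] have "frechet_derivative ?\<phi> (at g) v = 1"
      by (simp add: v)
    then show ?thesis by auto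
  qed
  with C2 have "local_defining_function {g. ?\<phi> g = 0} UNIV ?\<phi>"
    unfolding local_defining_function_def by auto
  then show ?thesis unfolding C2_surface_def by blast
qed

lemma C2_surface_strip1:
  assumes "C2_on G UNIV"
  shows "C2_surface (strip1 UNIV G)"
proof -
  have "strip1 UNIV G = {g. fst g + - fst (snd g) * G (snd (snd g)) = 0}"
    by (auto simp: strip1_def)
  moreover have "bounded_linear (\<lambda>g::heis. - fst (snd g))"
    by (intro bounded_linear_minus bounded_linear_compose[OF bounded_linear_fst bounded_linear_snd])
  ultimately show ?thesis
    using C2_surface_level_set[OF assms bounded_linear_fst, of "\<lambda>g. - fst (snd g)" "(1, 0, 0)"] by simp
qed

lemma C2_surface_strip2:
  assumes "C2_on G UNIV"
  shows "C2_surface (strip2 UNIV G)"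
proof -
  have "strip2 UNIV G = {g. fst (snd g) + fst g * G (snd (snd g)) = 0}"
    by (auto simp: strip2_def)
  moreover have "bounded_linear (\<lambda>g::heis. fst (snd g))"
    using bounded_linear_compose[OF bounded_linear_fst bounded_linear_snd] .
  ultimately show ?thesis
    using C2_surface_level_set[OF assms _ bounded_linear_fst, of "\<lambda>g. fst (snd g)" "(0, 1, 0)"] by simp
qed

section \<open>Intrinsic graphs\<close>

locale nondecreasing_C2 =
  fixes G :: "real \<Rightarrow> real"
  assumes C2: "C2_on G UNIV" and deriv_nonneg: "deriv G t \<ge> 0"
begin

text \<open>The equation for the third coordinate \<open>t\<close> of a graph point: inserting
  \<open>\<phi> = u * G t\<close> into \<open>t = v - u * \<phi> / 2\<close>, or
  \<open>\<phi> = - u * G t\<close> into \<open>t = v + u * \<phi> / 2\<close>, gives the same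
  condition, so one function serves both kinds of graph.\<close>

definition height :: "real \<times> real \<Rightarrow> real" where
  "height z = (THE t. t + (fst z)\<^sup>2 / 2 * G t = snd z)"

section \<open>Existence, uniqueness and regularity of the height\<close>

lemma DERIV_G: "(G has_real_derivative deriv G t) (at t)"
  using C2_on_real_deriv(1)[OF C2] by simp

lemma G_mono: "s \<le> t \<Longrightarrow> G s \<le> G t"
  using DERIV_nonneg_imp_nondecreasing[of s t G] DERIV_G deriv_nonneg by blast

text \<open>Monotonicity of \<open>G\<close> can only increase distances here; this yields both
  uniqueness and continuity of the height.\<close>

lemma expansive:
  assumes "c \<ge> 0"
  shows "\<bar>t - s\<bar> \<le> \<bar>(t + c * G t) - (s + c * G s)\<bar>"
proof -
  have "t - s \<le> (t + c * G t) - (s + c * G s)" if "s \<le> t" for s t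
    using mult_left_mono[OF G_mono[OF that] assms] by simp
  from this[of s t] this[of t s] show ?thesis by (cases "s \<le> t") auto
qed

lemma height_exists:
  assumes "c \<ge> 0"
  shows "\<exists>t. t + c * G t = v"
proof -
  \<comment> \<open>By monotonicity \<open>?K ?d\<close> is at least \<open>?d + c * G 0\<close>,
    hence at least \<open>v\<close>, and symmetrically at \<open>- ?d\<close>; the intermediate
    value theorem applies between them.\<close>
  let ?K = "\<lambda>t. t + c * G t" and ?d = "\<bar>v - G 0 * c\<bar>"
  have "c * G 0 \<le> c * G ?d" "c * G (- ?d) \<le> c * G 0"
    using assms by (intro mult_left_mono G_mono; simp)+
  then have le: "?K (- ?d) \<le> v" "v \<le> ?K ?d" "- ?d \<le> ?d"
    by (simp_all add: mult.commute)
  have "continuous_on {- ?d..?d} ?K"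
    using DERIV_isCont[OF DERIV_G] continuous_at_imp_continuous_on
    by (intro continuous_on_add continuous_on_mult_left continuous_on_id) blast
  from IVT'[of ?K, OF le this] obtain t where "?K t = v" by (elim exE conjE)
  then show ?thesis by (rule exI)
qed

lemma height_eq_iff: "height (u, v) = t \<longleftrightarrow> t + u\<^sup>2 / 2 * G t = v"
proof -
  have "\<exists>!t. t + u\<^sup>2 / 2 * G t = v"
  proof (rule ex_ex1I[OF height_exists])
    show "s = t" if "s + u\<^sup>2 / 2 * G s = v" "t + u\<^sup>2 / 2 * G t = v" for s t
      using expansive[of "u\<^sup>2 / 2" s t] that by simp
  qed simp
  moreover from theI'[OF this] have "height (u, v) + u\<^sup>2 / 2 * G (height (u, v)) = v"
    unfolding height_def by simp
  ultimately show ?thesis by blast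
qed

lemma height_equation: "height z + (fst z)\<^sup>2 / 2 * G (height z) = snd z"
  using height_eq_iff[of "fst z" "snd z" "height z"] by simp

text \<open>With the height frozen at its value at \<open>z\<close>, the defect in the equation at
  \<open>w\<close> is explicit, continuous in \<open>w\<close> and zero at \<open>z\<close>; by
  \<open>expansive\<close> it dominates the change of the height.\<close>

lemma isCont_height: "isCont height z"
proof -
  have "((\<lambda>w. snd w - (height z + (fst w)\<^sup>2 / 2 * G (height z))) \<longlongrightarrow>
      snd z - (height z + (fst z)\<^sup>2 / 2 * G (height z))) (at z)"
    by (intro tendsto_intros) auto
  then have lim: "((\<lambda>w. snd w - (height z + (fst w)\<^sup>2 / 2 * G (height z))) \<longlongrightarrow> 0) (at z)"
    using height_equation[of z] by simp
  have "norm (height w - height z) \<le>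
      norm (snd w - (height z + (fst w)\<^sup>2 / 2 * G (height z)))" for w
    using expansive[of "(fst w)\<^sup>2 / 2" "height w" "height z"] height_equation[of w] by simp
  then have "\<forall>\<^sub>F w in at z. norm (height w - height z) \<le>
      norm (snd w - (height z + (fst w)\<^sup>2 / 2 * G (height z)))"
    by (rule eventuallyI)
  from Lim_null_comparison[OF this tendsto_norm_zero[OF lim]]
  show ?thesis
    unfolding isCont_def by (rule LIM_zero_cancel)
qed

text \<open>This and \<open>height_u\<close> are the partial derivatives found by implicit
  differentiation of the height equation.\<close>

definition height_v :: "real \<times> real \<Rightarrow> real" where
  "height_v z = inverse (1 + (fst z)\<^sup>2 / 2 * deriv G (height z))"

definition height_u :: "real \<times> real \<Rightarrow> real" where
  "height_u z = - (fst z * G (height z) * height_v z)"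

lemma height_denominator: "1 + (fst z)\<^sup>2 / 2 * deriv G t > 0"
  using deriv_nonneg[of t] by (simp add: add_pos_nonneg)

text \<open>The map \<open>(u, t) \<mapsto> (u, t + u\<^sup>2 G(t) / 2)\<close> is inverse to \<open>(u, v) \<mapsto> (u, height (u, v))\<close>.\<close>

lemma has_derivative_height:
  "(height has_derivative (\<lambda>d. height_u z * fst d + height_v z * snd d)) (at z)"
proof -
  let ?f = "\<lambda>w::real \<times> real. (fst w, snd w + (fst w)\<^sup>2 / 2 * G (snd w))"
  let ?g = "\<lambda>w. (fst w, height w)"
  let ?g' = "\<lambda>d. (fst d, height_u z * fst d + height_v z * snd d)"
  let ?u = "fst z" and ?t = "height z"
  let ?f' = "\<lambda>d::real \<times> real. (fst d, snd d + (?u * fst d * G ?t + ?u\<^sup>2 / 2 * (deriv G ?t * snd d)))"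
  have "((\<lambda>w::real \<times> real. G (snd w)) has_derivative (\<lambda>d. snd d * deriv G ?t)) (at (?g z))"
    by (rule DERIV_compose_FDERIV[where f = G]) (auto intro: DERIV_G intro!: derivative_intros)
  then have f': "(?f has_derivative ?f') (at (?g z))"
    by (auto intro!: has_derivative_Pair derivative_eq_intros simp: algebra_simps)
  have g': "bounded_linear ?g'"
    by (intro bounded_linear_Pair bounded_linear_fst bounded_linear_add
        bounded_linear_const_mult bounded_linear_snd)
  have inv: "?g' \<circ> ?f' = id"
  proof
    fix d :: "real \<times> real"
    obtain a b where d: "d = (a, b)" by (cases d)
    have "height_v z * (1 + ?u\<^sup>2 / 2 * deriv G ?t) = 1"
      unfolding height_v_def using height_denominator[of z ?t] by (intro left_inverse) simp
    then have "- (?u * G ?t * height_v z) * a + height_v z * (b + (?u * a * G ?t + ?u\<^sup>2 / 2 * (deriv G ?t * b))) = b"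
      by algebra
    then show "(?g' \<circ> ?f') d = id d"
      unfolding d height_u_def by simp
  qed
  have cont: "isCont ?g z"
    using isCont_height by (intro continuous_intros)
  have "?f (?g w) = w" for w
    using height_equation[of w] by (simp add: prod_eq_iff)
  \<comment> \<open>Differentiability of the inverse map follows from its continuity and a left
    inverse of the derivative of \<open>?f\<close>.\<close>
  from has_derivative_inverse_basic[where g = ?g, OF f' g' inv cont open_UNIV UNIV_I this]
  have "(?g has_derivative ?g') (at z)" .
  from has_derivative_snd[OF this] show ?thesis
    by (simp only: snd_conv)
qed

text \<open>Bootstrapping: the partial derivatives are built from \<open>G\<close> and
  \<open>deriv G\<close> at the height. Continuity of the height makes them continuous, so the
  height is C1; this makes them C1 in turn, so the height is C2.\<close>

lemma C2_on_height: "C2_on height UNIV"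
proof -
  let ?h' = "\<lambda>z. height_u z *\<^sub>R fst_blinfun + height_v z *\<^sub>R snd_blinfun"
  have h': "(height has_derivative blinfun_apply (?h' z)) (at z)" for z
    using has_derivative_height[of z] by (simp add: plus_blinfun.rep_eq scaleR_blinfun.rep_eq)
  have cont: "continuous_on UNIV height"
    using isCont_height by (simp add: continuous_on_eq_continuous_at)
  have contG: "continuous_on UNIV (\<lambda>z. G (height z))" "continuous_on UNIV (\<lambda>z. deriv G (height z))"
    using C2_on_real_deriv(2,3)[OF C2, THEN C1_on_imp_continuous_on] cont continuous_on_compose2
    by blast+
  have nz: "1 + (fst z)\<^sup>2 / 2 * deriv G (height z) \<noteq> 0" for z :: "real \<times> real"
    using height_denominator[of z "height z"] by simp
  have "continuous_on UNIV ?h'"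
    unfolding height_u_def height_v_def using contG nz by (intro continuous_intros) auto
  with h' have C1: "C1_on height UNIV" by (rule C1_onI)
  have fst: "C1_on (\<lambda>z::real \<times> real. fst z) UNIV"
    by (intro C1_on_bounded_linear bounded_linear_fst)
  have C1G: "C1_on (\<lambda>z. G (height z)) UNIV" "C1_on (\<lambda>z. deriv G (height z)) UNIV"
    using C1_on_compose[OF C2_on_real_deriv(2)[OF C2] C1] C1_on_compose[OF C2_on_real_deriv(3)[OF C2] C1]
    by auto
  have "C1_on (\<lambda>z::real \<times> real. 1 + (fst z * fst z) * (1 / 2) * deriv G (height z)) UNIV"
    by (intro C1_on_add C1_on_mult C1_on_const fst C1G)
  then have v: "C1_on height_v UNIV"
    unfolding height_v_def[abs_def] using nz by (intro C1_on_inverse) (auto simp: power2_eq_square)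
  have "C1_on (\<lambda>z. (- 1) * (fst z * G (height z) * height_v z)) UNIV"
    by (intro C1_on_mult C1_on_const fst C1G v)
  then have u: "C1_on height_u UNIV"
    unfolding height_u_def[abs_def] by simp
  show ?thesis
    unfolding C2_on_iff_C1_derivative using h'
    by (intro conjI exI[of _ ?h'] C1_on_add C1_on_scaleR C1_on_const u v) auto
qed

section \<open>Whole-line strips as global intrinsic graphs\<close>

lemma C2_on_graph_function: "C2_on (\<lambda>z. c * fst z * G (height z)) UNIV"
  by (intro C2_on_mult C2_on_bounded_linear C2_on_compose_real[OF C2 C2_on_height]
      bounded_linear_const_mult bounded_linear_fst) auto

text \<open>By the height equation the graph point over \<open>(u, v)\<close> lies on the strip at
  height \<open>height (u, v)\<close>. Conversely the strip point with parameters \<open>y\<close>,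
  \<open>t\<close> is reached from \<open>u = y\<close>,
  \<open>v = t + y^2 / 2 * G t\<close>.\<close>

lemma intrinsic_X1_graph_strip1: "intrinsic_X1_graph_on UNIV (strip1 UNIV G)"
proof -
  let ?\<phi> = "\<lambda>z. 1 * fst z * G (height z)"
  have graph: "hmult (0, u, v) (?\<phi> (u, v), 0, 0) = (u * G (height (u, v)), u, height (u, v))" for u v
  proof -
    define t where "t = height (u, v)"
    have "t + u\<^sup>2 / 2 * G t = v" unfolding t_def using height_equation[of "(u, v)"] by simp
    then show ?thesis unfolding t_def[symmetric] by (auto simp: power2_eq_square)
  qed
  have "strip1 UNIV G = {hmult (0, u, v) (?\<phi> (u, v), 0, 0) | u v. (u, v) \<in> UNIV}"
    unfolding graph strip1_def by (auto simp: height_eq_iff) (metis height_eq_iff)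
  then show ?thesis
    unfolding intrinsic_X1_graph_on_def using C2_on_graph_function by blast
qed

lemma intrinsic_X2_graph_strip2: "intrinsic_X2_graph_on UNIV (strip2 UNIV G)"
proof -
  let ?\<phi> = "\<lambda>z. - 1 * fst z * G (height z)"
  have graph: "hmult (u, 0, v) (0, ?\<phi> (u, v), 0) = (u, - u * G (height (u, v)), height (u, v))" for u v
  proof -
    define t where "t = height (u, v)"
    have "t + u\<^sup>2 / 2 * G t = v" unfolding t_def using height_equation[of "(u, v)"] by simp
    then show ?thesis unfolding t_def[symmetric] by (auto simp: power2_eq_square)
  qed
  have "strip2 UNIV G = {hmult (u, 0, v) (0, ?\<phi> (u, v), 0) | u v. (u, v) \<in> UNIV}"
    unfolding graph strip2_def by (auto simp: height_eq_iff) (metis height_eq_iff)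
  then show ?thesis
    unfolding intrinsic_X2_graph_on_def using C2_on_graph_function by blast
qed

lemma H_minimal_strip:
  "H_minimal (strip1 UNIV G)" "H_minimal (strip2 UNIV G)"
  by (rule ruled_transversal_H_minimal[OF C2_surface_strip1[OF C2] horizontally_ruled_strip1
        contact_transversal_strip1[OF C2]], simp add: deriv_nonneg)
    (rule ruled_transversal_H_minimal[OF C2_surface_strip2[OF C2] horizontally_ruled_strip2
        contact_transversal_strip2[OF C2]], simp add: deriv_nonneg)

lemma global_intrinsic_H_minimal_graph_strip:
  "global_intrinsic_H_minimal_graph (strip1 UNIV G)"
  "global_intrinsic_H_minimal_graph (strip2 UNIV G)"
  unfolding global_intrinsic_H_minimal_graph_def global_intrinsic_graph_def
  using intrinsic_X1_graph_strip1 intrinsic_X2_graph_strip2 H_minimal_strip by blast+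

end

theorem theorem1p5:
  shows "(\<forall>S. graphical_strip S \<longrightarrow> H_minimal S \<and> char_locus S = {}) \<and>
         (\<forall>G S. C2_on G UNIV \<longrightarrow> (\<forall>t. deriv G t \<ge> 0) \<longrightarrow>
            (S = strip1 UNIV G \<or> S = strip2 UNIV G) \<longrightarrow>
            global_intrinsic_H_minimal_graph S)"
proof (intro conjI allI impI)
  fix S assume "graphical_strip S"
  then show "H_minimal S" by (rule graphical_strip_H_minimal)
  then show "char_locus S = {}" unfolding H_minimal_def by blast
next
  fix G :: "real \<Rightarrow> real" and S
  assume "C2_on G UNIV" "\<forall>t. deriv G t \<ge> 0"
  then interpret nondecreasing_C2 G by unfold_locales auto
  assume "S = strip1 UNIV G \<or> S = strip2 UNIV G"
  then show "global_intrinsic_H_minimal_graph S"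
    using global_intrinsic_H_minimal_graph_strip by blast
qed

end
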